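(* For all integers $k\ge1$, $$\mathrm m(C_k)\le\frac{\log(k+1)}{2}=\frac{\log k}{2}+\frac1{2k}+O\Big(\frac1{k^2}\Big).$$
   Context: For $k\ge1$ let $d=\phi(k)$ and $\zeta_k$ a primitive $k$-th root of unity. Every $k$-th root of unity is uniquely an integer linear combination of $1,\zeta_k,\dots,\zeta_k^{d-1}$; let $A_k\subset\mathbf Z^d$ be the set of the $k$ coefficient vectors, and $F_k(\mathbf x):=\sum_{\mathbf a\in A_k}\mathbf x^{\mathbf a}$ with $\mathbf x=(x_1,\dots,x_d)$. The cyclovariety $C_k$ is the hypersurface $x_0+F_k(\mathbf x)=0$ in $\mathbf G_m^{d+1}$, and $\mathrm m(C_k):=\int_{\mathbf T^{d+1}}\log|x_0+F_k(\mathbf x)|\,d\mu$, with $\mathbf T$ the complex unit circle and $\mu$ normalized Haar measure. *)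

theory Defs
  imports
    "HOL-Probability.Probability"
    "HOL-Number_Theory.Totient"
    "HOL-Library.Landau_Symbols"
begin

definition unit_circle :: "complex set" where
  "unit_circle = sphere 0 1"

definition circle_haar :: "complex measure" where
  "circle_haar = distr (uniform_measure lborel {0..1}) (restrict_space borel unit_circle)
     (\<lambda>t. cis (2 * pi * t))"

definition torus_haar :: "nat \<Rightarrow> (nat \<Rightarrow> complex) measure" where
  "torus_haar n = PiM {..<n} (\<lambda>_. circle_haar)"

definition primitive_root_of_unity :: "nat \<Rightarrow> complex \<Rightarrow> bool" where
  "primitive_root_of_unity k z \<longleftrightarrow> k \<ge> 1 \<and> z ^ k = 1 \<and> (\<forall>j. 1 \<le> j \<and> j < k \<longrightarrow> z ^ j \<noteq> 1)"

lemma primitive_root_of_unity_exists: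
  assumes "k \<ge> 1"
  shows "primitive_root_of_unity k (exp (2 * of_real pi * \<i> * of_nat 1 / of_nat k))"
proof -
  have pow: "exp (2 * of_real pi * \<i> * of_nat 1 / of_nat k) ^ j
      = exp (2 * of_real pi * \<i> * of_nat j / of_nat k)" for j
    by (simp add: algebra_simps flip: exp_of_nat_mult)
  have "exp (2 * of_real pi * \<i> * of_nat j / of_nat k) = 1 \<longleftrightarrow> k dvd j" for j
    using complex_root_unity_eq[OF assms, of j 0] by (simp add: cong_def mod_eq_0_iff_dvd)
  then show ?thesis
    unfolding primitive_root_of_unity_def pow using assms by (auto dest: dvd_imp_le)
qed

text \<open>Vectors in \<open>\<int>\<^sup>d\<close> are the extensional functions on \<open>{..<d}\<close>; entry \<open>i\<close> is the coefficient
  of \<open>\<zeta> ^ i\<close>, and hence the exponent of the variable \<open>x (Suc i)\<close>.\<close>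

definition root_coeffs :: "nat \<Rightarrow> complex \<Rightarrow> (nat \<Rightarrow> int) set" where
  "root_coeffs k \<zeta> =
     {a \<in> {..<totient k} \<rightarrow>\<^sub>E UNIV. (\<Sum>i<totient k. of_int (a i) * \<zeta> ^ i) ^ k = 1}"

definition cyclo_F :: "nat \<Rightarrow> complex \<Rightarrow> (nat \<Rightarrow> complex) \<Rightarrow> complex" where
  "cyclo_F k \<zeta> x = (\<Sum>a\<in>root_coeffs k \<zeta>. \<Prod>i<totient k. x (Suc i) powi a i)"

text \<open>The defining Laurent polynomial of the cyclovariety, in the variables \<open>x 0, \<dots>, x (totient k)\<close>.\<close>

definition cyclo_poly :: "nat \<Rightarrow> complex \<Rightarrow> (nat \<Rightarrow> complex) \<Rightarrow> complex" where
  "cyclo_poly k \<zeta> x = x 0 + cyclo_F k \<zeta> x"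

text \<open>Logarithmic Mahler measure in \<open>n\<close> variables. At zeros of \<open>P\<close> the integrand takes the value
  \<open>ln 0 = 0\<close>, which is immaterial when the zeros in the torus form a null set.
  The Bochner integral is \<open>0\<close> for a non-integrable integrand, so a claim about \<open>mahler_measure\<close>
  is meaningful only together with \<open>mahler_integrable\<close>.\<close>

definition mahler_integrable :: "nat \<Rightarrow> ((nat \<Rightarrow> complex) \<Rightarrow> complex) \<Rightarrow> bool" where
  "mahler_integrable n P \<longleftrightarrow> integrable (torus_haar n) (\<lambda>x. ln (norm (P x)))"

definition mahler_measure :: "nat \<Rightarrow> ((nat \<Rightarrow> complex) \<Rightarrow> complex) \<Rightarrow> real" where
  "mahler_measure n P = (\<integral>x. ln (norm (P x)) \<partial>torus_haar n)"

text \<open>\<open>circle_haar\<close> is the normalized Haar measure: a rotation-invariant probability measure.\<close>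

lemma measurable_cis_circle:
  "(\<lambda>t. cis (2 * pi * t)) \<in> borel \<rightarrow>\<^sub>M restrict_space borel unit_circle"
  by (rule measurable_restrict_space2)
     (auto simp: unit_circle_def intro!: borel_measurable_continuous_onI continuous_intros)

lemma space_circle_haar: "space circle_haar = unit_circle"
  by (simp add: circle_haar_def space_restrict_space)

lemma prob_space_circle_haar: "prob_space circle_haar"
  unfolding circle_haar_def
  by (rule prob_space.prob_space_distr)
     (auto intro!: prob_space_uniform_measure measurable_cis_circle
        simp: measurable_cong_sets[OF sets_uniform_measure refl])

lemma nn_integral_shift_periodic:
  fixes g :: "real \<Rightarrow> ennreal"
  assumes [measurable]: "g \<in> borel_measurable borel"
    and per: "\<And>t. g (t + 1) = g t" and s: "0 \<le> s" "s \<le> 1"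
  shows "(\<integral>\<^sup>+t. g (s + t) * indicator {0..<1} t \<partial>lborel)
       = (\<integral>\<^sup>+t. g t * indicator {0..<1} t \<partial>lborel)"
proof -
  have "(\<integral>\<^sup>+t. g t * indicator {1..<1+s} t \<partial>lborel)
      = (\<integral>\<^sup>+t. g (1 + t) * indicator {1..<1+s} (1 + t) \<partial>lborel)"
    by (subst nn_integral_real_affine[where c = 1 and t = 1]) simp_all
  also have "\<dots> = (\<integral>\<^sup>+t. g t * indicator {0..<s} t \<partial>lborel)"
    using per by (intro nn_integral_cong) (auto simp: indicator_def add.commute)
  finally have wrap: "(\<integral>\<^sup>+t. g t * indicator {1..<1+s} t \<partial>lborel)
      = (\<integral>\<^sup>+t. g t * indicator {0..<s} t \<partial>lborel)" .
  have "(\<integral>\<^sup>+t. g (s + t) * indicator {0..<1} t \<partial>lborel)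
      = (\<integral>\<^sup>+t. g (s + t) * indicator {s..<1+s} (s + t) \<partial>lborel)"
    by (intro nn_integral_cong) (auto simp: indicator_def)
  also have "\<dots> = (\<integral>\<^sup>+t. g t * indicator {s..<1+s} t \<partial>lborel)"
    using nn_integral_real_affine[where c = 1 and t = s
        and f = "\<lambda>t. g t * indicator {s..<1+s} t"] by simp
  also have "\<dots> = (\<integral>\<^sup>+t. g t * indicator {s..<1} t + g t * indicator {1..<1+s} t \<partial>lborel)"
    using s by (intro nn_integral_cong) (auto simp: indicator_def)
  also have "\<dots> = (\<integral>\<^sup>+t. g t * indicator {s..<1} t \<partial>lborel)
      + (\<integral>\<^sup>+t. g t * indicator {0..<s} t \<partial>lborel)"
    by (subst nn_integral_add) (simp_all add: wrap)
  also have "\<dots> = (\<integral>\<^sup>+t. g t * indicator {s..<1} t + g t * indicator {0..<s} t \<partial>lborel)"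
    by (subst nn_integral_add) simp_all
  also have "\<dots> = (\<integral>\<^sup>+t. g t * indicator {0..<1} t \<partial>lborel)"
    using s by (intro nn_integral_cong) (auto simp: indicator_def)
  finally show ?thesis .
qed

lemma nn_integral_circle_haar:
  assumes "f \<in> borel_measurable (restrict_space borel unit_circle)"
  shows "(\<integral>\<^sup>+z. f z \<partial>circle_haar)
       = (\<integral>\<^sup>+t. f (cis (2 * pi * t)) * indicator {0..<1} t \<partial>lborel)"
proof -
  have [measurable]: "(\<lambda>t. f (cis (2 * pi * t))) \<in> borel_measurable borel"
    using measurable_compose[OF measurable_cis_circle assms] .
  have "(\<integral>\<^sup>+z. f z \<partial>circle_haar)
      = (\<integral>\<^sup>+t. f (cis (2 * pi * t)) \<partial>uniform_measure lborel {0..1})"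
    unfolding circle_haar_def
    by (rule nn_integral_distr)
       (use measurable_cis_circle assms in \<open>simp_all add: measurable_cong_sets[OF sets_uniform_measure refl]\<close>)
  also have "\<dots> = (\<integral>\<^sup>+t. f (cis (2 * pi * t)) * indicator {0..1} t \<partial>lborel)"
    by (simp add: nn_integral_uniform_measure divide_ennreal_def)
  also have "\<dots> = (\<integral>\<^sup>+t. f (cis (2 * pi * t)) * indicator {0..<1} t \<partial>lborel)"
    by (rule nn_integral_cong_AE)
       (use AE_lborel_singleton[of "1::real"] in \<open>auto elim!: eventually_mono simp: indicator_def\<close>)
  finally show ?thesis .
qed

lemma circle_haar_rotation_invariant:
  assumes "u \<in> unit_circle"
  shows "distr circle_haar circle_haar (\<lambda>z. u * z) = circle_haar"
proof -
  let ?C = "restrict_space borel unit_circle :: complex measure"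
  have [simp, measurable_cong]: "sets circle_haar = sets ?C"
    by (simp add: circle_haar_def)
  have rot: "(\<lambda>z. u * z) \<in> ?C \<rightarrow>\<^sub>M ?C"
    by (rule measurable_restrict_space2)
       (use assms in \<open>auto simp: unit_circle_def norm_mult space_restrict_space
          intro!: measurable_restrict_space1 borel_measurable_continuous_onI continuous_intros\<close>)
  obtain v where v: "u = cis v" "0 \<le> v" "v < 2 * pi"
    using assms Arg2pi[of u] by (auto simp: unit_circle_def is_Arg_def cis_conv_exp)
  define s where "s = v / (2 * pi)"
  have s: "u = cis (2 * pi * s)" "0 \<le> s" "s \<le> 1"
    using v by (auto simp: s_def field_simps)
  show ?thesis
  proof (rule measure_eqI)
    fix A assume "A \<in> sets (distr circle_haar circle_haar (\<lambda>z. u * z))"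
    then have A: "A \<in> sets ?C" by simp
    let ?f = "indicator A :: complex \<Rightarrow> ennreal"
    have f: "?f \<in> borel_measurable ?C" using A by measurable
    have fr: "(\<lambda>z. ?f (u * z)) \<in> borel_measurable ?C"
      using measurable_compose[OF rot f] .
    have g: "(\<lambda>t. ?f (cis (2 * pi * t))) \<in> borel_measurable borel"
      using measurable_compose[OF measurable_cis_circle f] .
    have per: "cis (2 * pi * (t + 1)) = cis (2 * pi * t)" for t
      by (simp add: distrib_left flip: cis_mult)
    have rot': "(\<lambda>z. u * z) \<in> circle_haar \<rightarrow>\<^sub>M circle_haar"
      using rot by (simp cong: measurable_cong_sets)
    have "emeasure (distr circle_haar circle_haar (\<lambda>z. u * z)) A
        = (\<integral>\<^sup>+z. ?f z \<partial>distr circle_haar circle_haar (\<lambda>z. u * z))"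
      using A by simp
    also have "\<dots> = (\<integral>\<^sup>+z. ?f (u * z) \<partial>circle_haar)"
      by (rule nn_integral_distr[OF rot']) (use f in \<open>simp cong: measurable_cong_sets\<close>)
    also have "\<dots> = (\<integral>\<^sup>+t. ?f (cis (2 * pi * (s + t))) * indicator {0..<1} t \<partial>lborel)"
      by (subst nn_integral_circle_haar[OF fr]) (simp add: s(1) cis_mult distrib_left)
    also have "\<dots> = (\<integral>\<^sup>+t. ?f (cis (2 * pi * t)) * indicator {0..<1} t \<partial>lborel)"
      by (rule nn_integral_shift_periodic[OF g _ s(2,3)]) (simp add: per)
    also have "\<dots> = (\<integral>\<^sup>+z. ?f z \<partial>circle_haar)"
      by (rule nn_integral_circle_haar[OF f, symmetric])
    also have "\<dots> = emeasure circle_haar A" using A by simp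
    finally show "emeasure (distr circle_haar circle_haar (\<lambda>z. u * z)) A = emeasure circle_haar A" .
  qed simp
qed

end

theory Submission
  imports Defs "HOL-Real_Asymp.Real_Asymp"
begin

text \<open>
  The bound is concavity of the logarithm combined with Parseval's identity. By concavity, the
  mean of \<open>ln \<bar>P\<bar>\<^sup>2\<close> over the torus is at most the logarithm of the mean of \<open>\<bar>P\<bar>\<^sup>2\<close>, and the
  latter mean is the number of monomials of \<open>P\<close> when these are distinct and have coefficient 1
  (\<open>torus_parseval\<close>). The polynomial of the cyclovariety has the monomial \<open>x\<^sub>0\<close> and one monomial for each
  \<open>k\<close>-th root of unity, so \<open>2 m(C\<^sub>k) \<le> ln (k + 1)\<close>.

  The logarithm is unbounded near the zeros of \<open>P\<close>, so integrability needs an argument.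
  Since \<open>\<bar>ln y\<bar> \<le> y\<^sup>2 + 2 / sqrt y\<close>, it suffices that \<open>1 / sqrt \<bar>P\<bar>\<close> has a finite integral, with value
  \<open>\<infinity>\<close> at the zeros; the same fact shows that the zeros form a null set, which concavity needs
  because \<open>ln 0 = 0\<close> here. As \<open>P = x\<^sub>0 + F\<close> with \<open>F\<close> independent of \<open>x\<^sub>0\<close>, it is enough to bound the
  integral of \<open>1 / sqrt \<bar>z + c\<bar>\<close> over the circle uniformly in \<open>c\<close>
  (\<open>nn_integral_inverse_sqrt_translate\<close>). After a rotation \<open>c\<close> is a nonnegative real, and then
  \<open>\<bar>2 t - 1\<bar>\<close> is a lower bound for \<open>\<bar>cis (2 \<pi> t) + c\<bar>\<close> whose inverse square root integrates to 2.

  The count of monomials rests on a dichotomy. If two coefficient vectors represented the same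
  root of unity, adding multiples of their difference would give infinitely many representations.
  So a finite set of coefficient vectors injects into the \<open>k\<close>-th roots of unity, and a sum over an
  infinite set is 0 by convention; in both cases \<open>F\<close> is a sum of at most \<open>k\<close> distinct monomials
  (\<open>cyclo_F_as_finite_sum\<close>).
\<close>

section \<open>Haar measure on the circle and the torus\<close>

lemma sets_circle_haar [measurable_cong]:
  "sets circle_haar = sets (restrict_space borel unit_circle)"
  by (simp add: circle_haar_def)

lemma borel_measurable_circle_haar:
  "f \<in> borel_measurable borel \<Longrightarrow> f \<in> borel_measurable circle_haar"
  unfolding measurable_cong_sets[OF sets_circle_haar refl]
  by (rule measurable_restrict_space1)

interpretation circle_haar: prob_space circle_haar
  by (rule prob_space_circle_haar)

interpretation torus_factors: product_sigma_finite "\<lambda>_::nat. circle_haar"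
  by standard

lemma prob_space_torus_haar: "prob_space (torus_haar n)"
  unfolding torus_haar_def by (rule prob_space_PiM) (rule prob_space_circle_haar)

lemma norm_torus_coordinate:
  "x \<in> space (torus_haar n) \<Longrightarrow> i < n \<Longrightarrow> norm (x i) = 1"
  by (auto simp: torus_haar_def space_PiM PiE_iff space_circle_haar unit_circle_def)

lemma measurable_rotation:
  assumes "norm u = 1"
  shows "(\<lambda>z. u * z) \<in> circle_haar \<rightarrow>\<^sub>M circle_haar"
  unfolding measurable_cong_sets[OF refl sets_circle_haar]
  by (rule measurable_restrict_space2)
     (use assms in \<open>auto simp: space_circle_haar unit_circle_def norm_mult intro!: borel_measurable_circle_haar\<close>)

lemma rotation_integral_circle_haar:
  fixes f :: "complex \<Rightarrow> complex"
  assumes [measurable]: "f \<in> borel_measurable borel" and u: "norm u = 1"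
  shows "(\<integral>z. f (u * z) \<partial>circle_haar) = (\<integral>z. f z \<partial>circle_haar)"
proof -
  have "(\<lambda>z. u * z) \<in> circle_haar \<rightarrow>\<^sub>M circle_haar"
    by (rule measurable_rotation) fact
  from integral_distr[OF this, of f] show ?thesis
    using u by (simp add: circle_haar_rotation_invariant unit_circle_def borel_measurable_circle_haar)
qed

lemma rotation_nn_integral_circle_haar:
  fixes f :: "complex \<Rightarrow> ennreal"
  assumes [measurable]: "f \<in> borel_measurable borel" and u: "norm u = 1"
  shows "(\<integral>\<^sup>+z. f (u * z) \<partial>circle_haar) = (\<integral>\<^sup>+z. f z \<partial>circle_haar)"
proof -
  have "(\<lambda>z. u * z) \<in> circle_haar \<rightarrow>\<^sub>M circle_haar"
    by (rule measurable_rotation) fact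
  from nn_integral_distr[OF this, of f] show ?thesis
    using u by (simp add: circle_haar_rotation_invariant unit_circle_def borel_measurable_circle_haar)
qed

lemma measurable_power_int [measurable]:
  fixes f :: "'a \<Rightarrow> complex"
  assumes [measurable]: "f \<in> borel_measurable M"
  shows "(\<lambda>x. f x powi n) \<in> borel_measurable M"
  by (cases "n \<ge> 0") (simp_all add: power_int_def)

section \<open>Inverse square roots of distances to the circle\<close>

text \<open>Jordan's inequality: a concave function lies above its chords.\<close>

lemma chord_le_sin:
  assumes "0 \<le> s" "s \<le> 1"
  shows "s \<le> sin (pi / 2 * s)"
proof -
  have "convex_on {0..pi/2} (\<lambda>x. - sin x)"
    by (rule f''_ge0_imp_convex[where f' = "\<lambda>x. - cos x" and f'' = sin])
       (auto intro!: derivative_eq_intros sin_ge_zero)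
  from convex_onD[OF this, of s 0 "pi / 2"] assms show ?thesis
    by (simp add: mult.commute)
qed

text \<open>
  For \<open>r \<ge> 0\<close>, a point of the circle can be close to \<open>-r\<close> only near \<open>-1\<close>, that is for \<open>t\<close> near
  \<open>1/2\<close>. Quantitatively, \<open>\<bar>cos (\<pi> t)\<bar>\<close> is an intermediate bound: on the right half circle the
  distance is at least 1; on the left half circle it is at least the height \<open>\<bar>sin (2 \<pi> t)\<bar>\<close>, which
  is \<open>2 \<bar>sin (\<pi> t)\<bar> \<bar>cos (\<pi> t)\<bar>\<close> with \<open>2 \<bar>sin (\<pi> t)\<bar> \<ge> 1\<close> there.
\<close>

lemma norm_cis_add_ge:
  assumes t: "0 \<le> t" "t \<le> 1" and r: "0 \<le> r"
  shows "\<bar>2 * t - 1\<bar> \<le> norm (cis (2 * pi * t) + of_real r)"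
proof -
  have "\<bar>2 * t - 1\<bar> \<le> \<bar>cos (pi * t)\<bar>"
  proof -
    have sin_le: "sin (a * \<bar>b\<bar>) \<le> \<bar>sin (a * b)\<bar>" for a b :: real
      by (cases "b \<ge> 0") auto
    have "\<bar>2 * t - 1\<bar> \<le> sin (pi / 2 * \<bar>2 * t - 1\<bar>)"
      using t by (intro chord_le_sin) auto
    also have "\<dots> \<le> \<bar>sin (pi / 2 * (2 * t - 1))\<bar>"
      using sin_le[of "pi / 2" "2 * t - 1"] .
    also have "sin (pi / 2 * (2 * t - 1)) = - cos (pi * t)"
      by (simp add: sin_diff algebra_simps)
    finally show ?thesis by simp
  qed
  also have "(cos (pi * t))\<^sup>2 \<le> (norm (cis (2 * pi * t) + of_real r))\<^sup>2"
  proof -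
    have c: "cos (2 * pi * t) = 2 * (cos (pi * t))\<^sup>2 - 1"
      using cos_double_cos[of "pi * t"] by (simp add: mult.assoc)
    have "(norm (cis (2 * pi * t) + of_real r))\<^sup>2 = (cos (2*pi*t) + r)\<^sup>2 + (sin (2*pi*t))\<^sup>2"
      by (simp add: cmod_power2)
    also have "\<dots> = (cos (2*pi*t) + r)\<^sup>2 + (1 - (cos (2*pi*t))\<^sup>2)"
      by (simp add: sin_squared_eq)
    finally have n: "(norm (cis (2 * pi * t) + of_real r))\<^sup>2 = \<dots>" .
    have q: "0 \<le> (cos (pi * t))\<^sup>2" "(cos (pi * t))\<^sup>2 \<le> 1"
      by (simp_all add: abs_square_le_1)
    have expand: "(y + r)\<^sup>2 + (1 - y\<^sup>2) = 1 + r\<^sup>2 + 2 * (r * y)" for y :: real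
      by (simp add: power2_eq_square algebra_simps)
    show ?thesis
    proof (cases "cos (2 * pi * t) \<ge> 0")
      case True
      then have "0 \<le> r * cos (2 * pi * t)" "0 \<le> r\<^sup>2" using r by auto
      then show ?thesis unfolding n expand using q by linarith
    next
      case False
      have "0 \<le> (- cos (2*pi*t)) * (1 + cos (2*pi*t))"
        by (intro mult_nonneg_nonneg) (use False c q in linarith)+
      then have "(cos (2*pi*t))\<^sup>2 \<le> - cos (2*pi*t)"
        by (simp add: power2_eq_square algebra_simps)
      moreover have "0 \<le> (cos (2*pi*t) + r)\<^sup>2" by simp
      ultimately show ?thesis unfolding n using c q by linarith
    qed
  qed
  then have "\<bar>cos (pi * t)\<bar> \<le> norm (cis (2 * pi * t) + of_real r)"
    by (metis abs_le_square_iff abs_norm_cancel)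
  finally show ?thesis .
qed

lemma ennreal_inverse_antimono:
  assumes "0 \<le> a" "a \<le> b"
  shows "inverse (ennreal b) \<le> inverse (ennreal a)"
  using assms by (cases "a = 0") (auto simp: inverse_ennreal ennreal_leI le_imp_inverse_le)

lemma nn_integral_inverse_sqrt_linear:
  "(\<integral>\<^sup>+t. inverse (ennreal (sqrt \<bar>2 * t - 1\<bar>)) * indicator {0..<1} t \<partial>lborel) = 2"
proof -
  (* sqrt is an odd function on the reals, so sqrt (2 t - 1) is an antiderivative on both sides
     of the singularity and is continuous across it. *)
  have "((\<lambda>t. inverse (sqrt \<bar>2 * t - 1\<bar>)) has_integral (sqrt (2 * 1 - 1) - sqrt (2 * 0 - 1))) {0..1::real}"
  proof (rule fundamental_theorem_of_calculus_interior_strong[where S = "{1/2}"])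
    fix t :: real assume "t \<in> {0<..<1} - {1 / 2}"
    then have "2 * t - 1 \<noteq> 0" by auto
    then have "((\<lambda>t. sqrt (2 * t - 1)) has_real_derivative inverse (sqrt \<bar>2 * t - 1\<bar>)) (at t)"
    proof (cases "2 * t - 1 > 0")
      case True
      have "((\<lambda>t. sqrt (2 * t - 1)) has_real_derivative inverse (sqrt (2 * t - 1)) / 2 * 2) (at t)"
        by (rule DERIV_chain2[where g = "\<lambda>t. 2 * t - 1", OF DERIV_real_sqrt[OF True]]) (auto intro!: derivative_eq_intros)
      then show ?thesis using True by simp
    next
      case False
      then have "1 - 2 * t > 0" using \<open>2 * t - 1 \<noteq> 0\<close> by simp
      have "((\<lambda>t. - sqrt (1 - 2 * t)) has_real_derivative - (inverse (sqrt (1 - 2 * t)) / 2 * (- 2))) (at t)"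
        by (rule DERIV_minus, rule DERIV_chain2[where g = "\<lambda>t. 1 - 2 * t", OF DERIV_real_sqrt[OF \<open>1 - 2 * t > 0\<close>]])
           (auto intro!: derivative_eq_intros)
      then show ?thesis using \<open>1 - 2 * t > 0\<close> by (simp flip: real_sqrt_minus)
    qed
    then show "((\<lambda>t. sqrt (2 * t - 1)) has_vector_derivative inverse (sqrt \<bar>2 * t - 1\<bar>)) (at t)"
      by (simp add: has_real_derivative_iff_has_vector_derivative)
  qed (auto intro!: continuous_intros)
  then have "(\<integral>\<^sup>+t. ennreal (indicator {0..1} t * inverse (sqrt \<bar>2 * t - 1\<bar>)) \<partial>lborel) = 2"
    by (subst nn_integral_has_integral_lebesgue) (auto simp: real_sqrt_minus)
  moreover have "(\<integral>\<^sup>+t. ennreal (indicator {0..1} t * inverse (sqrt \<bar>2 * t - 1\<bar>)) \<partial>lborel)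
     = (\<integral>\<^sup>+t. inverse (ennreal (sqrt \<bar>2 * t - 1\<bar>)) * indicator {0..<1} t \<partial>lborel)"
    by (rule nn_integral_cong_AE)
       (use AE_lborel_singleton[of "1::real"] AE_lborel_singleton[of "1/2::real"] in
         \<open>eventually_elim, auto simp: indicator_def inverse_ennreal\<close>)
  ultimately show ?thesis by simp
qed

text \<open>
  The uniformity in \<open>c\<close> is what permits integrating over the other coordinates of a torus
  afterwards. Taking the inverse in \<open>ennreal\<close> gives the value \<open>\<infinity>\<close> at \<open>z = -c\<close>, so that finiteness
  of the integral carries information about the zero set.
\<close>

lemma nn_integral_inverse_sqrt_translate:
  "(\<integral>\<^sup>+z. inverse (ennreal (sqrt (norm (z + c)))) \<partial>circle_haar) \<le> 2"
proof -
  define r where "r = norm c"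
  obtain u where u: "norm u = 1" "c = u * of_real r"
    by (rule that[of "if c = 0 then 1 else sgn c"])
       (auto simp: r_def sgn_eq norm_divide)
  have "(\<integral>\<^sup>+z. inverse (ennreal (sqrt (norm (z + c)))) \<partial>circle_haar)
      = (\<integral>\<^sup>+z. inverse (ennreal (sqrt (norm (u * z + c)))) \<partial>circle_haar)"
    by (rule rotation_nn_integral_circle_haar[symmetric, OF _ u(1)]) auto
  also have "\<dots> = (\<integral>\<^sup>+z. inverse (ennreal (sqrt (norm (z + of_real r)))) \<partial>circle_haar)"
    using u by (simp add: norm_mult flip: distrib_left)
  also have "\<dots> = (\<integral>\<^sup>+t. inverse (ennreal (sqrt (norm (cis (2 * pi * t) + of_real r))))
                      * indicator {0..<1} t \<partial>lborel)"
    by (rule nn_integral_circle_haar) (auto intro!: measurable_restrict_space1)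
  also have "\<dots> \<le> (\<integral>\<^sup>+t. inverse (ennreal (sqrt \<bar>2 * t - 1\<bar>)) * indicator {0..<1} t \<partial>lborel)"
  proof (rule nn_integral_mono)
    fix t :: real
    show "inverse (ennreal (sqrt (norm (cis (2 * pi * t) + of_real r)))) * indicator {0..<1} t
        \<le> inverse (ennreal (sqrt \<bar>2 * t - 1\<bar>)) * indicator {0..<1} t"
      using norm_cis_add_ge[of t r]
      by (auto simp: indicator_def r_def intro!: ennreal_inverse_antimono)
  qed
  also have "\<dots> = 2" by (rule nn_integral_inverse_sqrt_linear)
  finally show ?thesis .
qed

section \<open>Parseval's identity on the torus\<close>

text \<open>
  For \<open>n \<noteq> 0\<close>, rotation by an \<open>n\<close>-th root of \<open>-1\<close> preserves the integral but changes its sign.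
\<close>

lemma integral_circle_haar_power_int:
  "(\<integral>z. z powi n \<partial>circle_haar) = (if n = 0 then 1 else 0)"
proof (cases "n = 0")
  case False
  define u where "u = cis (pi / of_int n)"
  have "u powi n = -1" using False by (simp add: u_def cis_power_int)
  moreover have "(\<integral>z. (u * z) powi n \<partial>circle_haar) = (\<integral>z. z powi n \<partial>circle_haar)"
    by (rule rotation_integral_circle_haar) (auto simp: u_def)
  ultimately show ?thesis using False
    by (simp add: power_int_mult_distrib)
qed (simp add: circle_haar.prob_space)

lemma integrable_circle_haar_power_int: "integrable circle_haar (\<lambda>z. z powi n)"
  by (rule circle_haar.integrable_const_bound[where B = 1])
     (auto simp: space_circle_haar unit_circle_def norm_power_int
        intro!: borel_measurable_circle_haar)

definition monomial :: "nat \<Rightarrow> (nat \<Rightarrow> int) \<Rightarrow> (nat \<Rightarrow> complex) \<Rightarrow> complex" where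
  "monomial n e x = (\<Prod>i<n. x i powi e i)"

lemma measurable_torus_coordinate [measurable]:
  "i < n \<Longrightarrow> (\<lambda>x. x i) \<in> borel_measurable (torus_haar n)"
  unfolding torus_haar_def
  by (rule measurable_compose[where f = "\<lambda>x. x i" and g = "\<lambda>z. z" and N = circle_haar])
     (auto intro: borel_measurable_circle_haar)

lemma measurable_monomial [measurable]: "monomial n e \<in> borel_measurable (torus_haar n)"
  unfolding monomial_def by (auto intro!: borel_measurable_prod measurable_power_int measurable_torus_coordinate)

lemma monomial_orthogonal:
  "integrable (torus_haar n) (\<lambda>x. monomial n e x * cnj (monomial n e' x))"
  "(\<integral>x. monomial n e x * cnj (monomial n e' x) \<partial>torus_haar n) = (if \<forall>i<n. e i = e' i then 1 else 0)"
proof -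
  have eq: "monomial n e x * cnj (monomial n e' x) = (\<Prod>i<n. x i powi (e i - e' i))"
    if "x \<in> space (torus_haar n)" for x
  proof -
    have "x i powi e i * cnj (x i powi e' i) = x i powi (e i - e' i)" if "i < n" for i
    proof -
      have "norm (x i) = 1" using norm_torus_coordinate[OF \<open>x \<in> _\<close> that] .
      moreover from this have "cnj (x i powi e' i) = inverse (x i powi e' i)"
        by (simp add: divide_conv_cnj[of _ 1, simplified] norm_power_int inverse_eq_divide)
      moreover have "x i \<noteq> 0" using \<open>norm (x i) = 1\<close> by auto
      ultimately show ?thesis by (simp add: power_int_diff field_simps)
    qed
    then show ?thesis
      by (simp add: monomial_def flip: prod.distrib)
  qed
  have "integrable (torus_haar n) (\<lambda>x. \<Prod>i<n. x i powi (e i - e' i))"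
    unfolding torus_haar_def
    by (rule torus_factors.product_integrable_prod) (auto intro: integrable_circle_haar_power_int)
  then show "integrable (torus_haar n) (\<lambda>x. monomial n e x * cnj (monomial n e' x))"
    using eq by (simp cong: Bochner_Integration.integrable_cong)
  have "(\<integral>x. monomial n e x * cnj (monomial n e' x) \<partial>torus_haar n)
      = (\<Prod>i<n. \<integral>z. z powi (e i - e' i) \<partial>circle_haar)"
    using eq unfolding torus_haar_def
    by (subst torus_factors.product_integral_prod[symmetric])
       (auto intro: integrable_circle_haar_power_int intro!: Bochner_Integration.integral_cong)
  then show "(\<integral>x. monomial n e x * cnj (monomial n e' x) \<partial>torus_haar n) = (if \<forall>i<n. e i = e' i then 1 else 0)"
    by (auto simp: integral_circle_haar_power_int)
qed

text \<open>
  Exponents are compared on \<open>{..<n}\<close> only, since a monomial in \<open>n\<close> variables does not see the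
  other entries; \<open>sep\<close> states that the monomials are distinct.
\<close>

lemma torus_parseval:
  assumes E: "finite E" and sep: "\<And>e e'. e \<in> E \<Longrightarrow> e' \<in> E \<Longrightarrow> (\<forall>i<n. e i = e' i) \<Longrightarrow> e = e'"
  shows "integrable (torus_haar n) (\<lambda>x. (norm (\<Sum>e\<in>E. monomial n e x))\<^sup>2)"
    and "(\<integral>x. (norm (\<Sum>e\<in>E. monomial n e x))\<^sup>2 \<partial>torus_haar n) = card E"
proof -
  let ?P = "\<lambda>x. \<Sum>e\<in>E. monomial n e x"
  let ?D = "\<lambda>x. \<Sum>e\<in>E. \<Sum>e'\<in>E. monomial n e x * cnj (monomial n e' x)"
  have eq: "(norm (?P x))\<^sup>2 = Re (?D x)" for x
  proof -
    have "?D x = ?P x * cnj (?P x)" by (simp add: sum_product cnj_sum)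
    then show ?thesis by (simp add: complex_mult_cnj cmod_power2 del: cnj_sum)
  qed
  have int: "integrable (torus_haar n) ?D"
    by (intro Bochner_Integration.integrable_sum monomial_orthogonal)
  then show "integrable (torus_haar n) (\<lambda>x. (norm (?P x))\<^sup>2)"
    unfolding eq by (rule integrable_Re)
  have "(\<integral>x. ?D x \<partial>torus_haar n) = (\<Sum>e\<in>E. \<Sum>e'\<in>E. if \<forall>i<n. e i = e' i then 1 else 0)"
    by (simp add: Bochner_Integration.integrable_sum Bochner_Integration.integral_sum monomial_orthogonal)
  also have "\<dots> = (\<Sum>e\<in>E. \<Sum>e'\<in>E. if e = e' then 1 else 0)"
    using sep by (intro sum.cong) auto
  also have "\<dots> = of_nat (card E)" using E by simp
  finally show "(\<integral>x. (norm (?P x))\<^sup>2 \<partial>torus_haar n) = card E"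
    unfolding eq using integral_Re[OF int] by simp
qed

section \<open>Mahler measure and the mean square\<close>

lemma nn_integral_inverse_sqrt_torus:
  assumes [measurable]: "F \<in> borel_measurable (torus_haar (Suc n))"
    and indep: "\<And>x z. F (x(0 := z)) = F x"
  shows "(\<integral>\<^sup>+x. inverse (ennreal (sqrt (norm (x 0 + F x)))) \<partial>torus_haar (Suc n)) \<le> 2"
proof -
  have split: "{..<Suc n} = insert 0 {1..<Suc n}" by auto
  interpret rest: prob_space "PiM {1..<Suc n} (\<lambda>_. circle_haar)"
    by (rule prob_space_PiM) (rule prob_space_circle_haar)
  have [measurable]: "(\<lambda>x. inverse (ennreal (sqrt (norm (x 0 + F x))))) \<in> borel_measurable (torus_haar (Suc n))"
    using measurable_torus_coordinate[of 0 "Suc n"] by measurable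
  have "(\<integral>\<^sup>+x. inverse (ennreal (sqrt (norm (x 0 + F x)))) \<partial>torus_haar (Suc n))
      = (\<integral>\<^sup>+x. (\<integral>\<^sup>+z. inverse (ennreal (sqrt (norm (z + F x)))) \<partial>circle_haar)
            \<partial>PiM {1..<Suc n} (\<lambda>_. circle_haar))"
    using \<open>(\<lambda>x. inverse (ennreal (sqrt (norm (x 0 + F x))))) \<in> _\<close>
    unfolding torus_haar_def split
    by (subst torus_factors.product_nn_integral_insert) (auto simp: indep)
  also have "\<dots> \<le> (\<integral>\<^sup>+x. 2 \<partial>PiM {1..<Suc n} (\<lambda>_. circle_haar))"
    by (intro nn_integral_mono nn_integral_inverse_sqrt_translate)
  also have "\<dots> = 2" by (simp add: rest.emeasure_space_1[simplified])
  finally show ?thesis .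
qed

text \<open>
  Jensen's inequality for the logarithm, in the form of its tangent line at \<open>M\<close>: integrating
  \<open>ln (y\<^sup>2 / M) \<le> y\<^sup>2 / M - 1\<close> with \<open>y = \<bar>P x\<bar>\<close> leaves a nonpositive right-hand side. The tangent
  line bound can fail at \<open>y = 0\<close>, where \<open>ln\<close> is 0, hence the use of \<open>inv\<close> to discard the zeros.
\<close>

lemma mahler_measure_le_half_ln_L2:
  assumes [measurable]: "P \<in> borel_measurable (torus_haar n)"
    and sq: "integrable (torus_haar n) (\<lambda>x. (norm (P x))\<^sup>2)"
    and M: "(\<integral>x. (norm (P x))\<^sup>2 \<partial>torus_haar n) \<le> M" "M > 0"
    and inv: "(\<integral>\<^sup>+x. inverse (ennreal (sqrt (norm (P x)))) \<partial>torus_haar n) < \<infinity>"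
  shows "mahler_integrable n P" and "mahler_measure n P \<le> ln M / 2"
proof -
  interpret torus: prob_space "torus_haar n" by (rule prob_space_torus_haar)
  have nz: "AE x in torus_haar n. P x \<noteq> 0"
  proof -
    have "AE x in torus_haar n. inverse (ennreal (sqrt (norm (P x)))) \<noteq> \<infinity>"
      by (rule nn_integral_noteq_infinite) (use inv in auto)
    then show ?thesis by eventually_elim auto
  qed
  have bound: "ennreal \<bar>ln y\<bar> \<le> ennreal (y\<^sup>2) + 2 * inverse (ennreal (sqrt y))" if "y \<ge> 0" for y
  proof (cases "y \<ge> 1")
    case True
    have "\<bar>ln y\<bar> \<le> y\<^sup>2"
      using ln_le_minus_one[of y] True power_increasing[of 1 2 y] by auto
    then show ?thesis by (simp add: ennreal_leI add_increasing2)
  next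
    case False
    show ?thesis
    proof (cases "y = 0")
      case False
      with that \<open>\<not> 1 \<le> y\<close> have y: "0 < y" "y < 1" by auto
      (* ln v \<le> v at v = 1 / sqrt y trades the logarithmic singularity for a power of y. *)
      have "ln (inverse (sqrt y)) \<le> inverse (sqrt y)"
        using ln_le_minus_one[of "inverse (sqrt y)"] y by auto
      then have "\<bar>ln y\<bar> \<le> 2 * inverse (sqrt y)"
        using y by (simp add: ln_inverse ln_sqrt)
      then have "ennreal \<bar>ln y\<bar> \<le> ennreal (2 * inverse (sqrt y))" by (rule ennreal_leI)
      also have "\<dots> = 2 * inverse (ennreal (sqrt y))"
        using y by (simp add: inverse_ennreal ennreal_mult)
      finally show ?thesis by (simp add: add_increasing)
    qed simp
  qed
  have int: "integrable (torus_haar n) (\<lambda>x. ln (norm (P x)))"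
  proof (rule integrableI_bounded)
    have "(\<integral>\<^sup>+x. norm (ln (norm (P x))) \<partial>torus_haar n)
        \<le> (\<integral>\<^sup>+x. ennreal ((norm (P x))\<^sup>2) + 2 * inverse (ennreal (sqrt (norm (P x)))) \<partial>torus_haar n)"
      using bound by (intro nn_integral_mono) simp
    also have "\<dots> = (\<integral>\<^sup>+x. ennreal ((norm (P x))\<^sup>2) \<partial>torus_haar n)
        + 2 * (\<integral>\<^sup>+x. inverse (ennreal (sqrt (norm (P x)))) \<partial>torus_haar n)"
      by (subst nn_integral_add) (auto simp: nn_integral_cmult)
    also have "\<dots> < \<infinity>"
      using inv by (auto simp: nn_integral_eq_integral[OF sq] ennreal_mult_less_top)
    finally show "(\<integral>\<^sup>+x. norm (ln (norm (P x))) \<partial>torus_haar n) < \<infinity>" .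
  qed simp
  then show "mahler_integrable n P" by (simp add: mahler_integrable_def)
  have "mahler_measure n P \<le> (\<integral>x. ((norm (P x))\<^sup>2 / M - 1 + ln M) / 2 \<partial>torus_haar n)"
    unfolding mahler_measure_def
  proof (rule integral_mono_AE)
    show "AE x in torus_haar n. ln (norm (P x)) \<le> ((norm (P x))\<^sup>2 / M - 1 + ln M) / 2"
      using nz
    proof eventually_elim
      case (elim x)
      then have "ln ((norm (P x))\<^sup>2 / M) \<le> (norm (P x))\<^sup>2 / M - 1"
        using M by (intro ln_le_minus_one) auto
      then show ?case using elim M by (simp add: ln_div ln_realpow)
    qed
  qed (use int sq in auto)
  also have "\<dots> = ((\<integral>x. (norm (P x))\<^sup>2 \<partial>torus_haar n) / M - 1 + ln M) / 2"
    using sq by (simp add: torus.prob_space)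
  also have "\<dots> \<le> ln M / 2" using M by (simp add: field_simps)
  finally show "mahler_measure n P \<le> ln M / 2" .
qed

section \<open>The cyclovariety\<close>

text \<open>
  Evaluation at \<open>\<zeta>\<close> maps coefficient vectors to the \<open>k\<close>-th roots of unity. It is injective: if
  \<open>a\<close> and \<open>b\<close> had the same value, so would all the vectors \<open>a + m (b - a)\<close>, against finiteness.
\<close>

lemma card_root_coeffs_le:
  assumes k: "k \<ge> 1" and fin: "finite (root_coeffs k \<zeta>)"
  shows "card (root_coeffs k \<zeta>) \<le> k"
proof -
  let ?d = "totient k"
  let ?v = "\<lambda>a::nat \<Rightarrow> int. \<Sum>i<?d. of_int (a i) * \<zeta> ^ i"
  have inj: "inj_on ?v (root_coeffs k \<zeta>)"
  proof (rule inj_onI, rule ccontr)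
    fix a b assume a: "a \<in> root_coeffs k \<zeta>" and b: "b \<in> root_coeffs k \<zeta>"
      and eq: "?v a = ?v b" and ne: "a \<noteq> b"
    define c where "c m = restrict (\<lambda>i. a i + int m * (b i - a i)) {..<?d}" for m
    have "?v (c m) = ?v a + of_nat m * (?v b - ?v a)" for m
      by (simp add: c_def sum.distrib sum_subtractf sum_distrib_left algebra_simps)
    then have "range c \<subseteq> root_coeffs k \<zeta>"
      using a eq by (auto simp: root_coeffs_def c_def)
    moreover have "inj c"
    proof (rule injI)
      fix m m' assume "c m = c m'"
      obtain i where "i < ?d" "a i \<noteq> b i"
        using a b ne by (auto simp: root_coeffs_def dest: PiE_ext)
      with fun_cong[OF \<open>c m = c m'\<close>, of i] show "m = m'"
        by (simp add: c_def)
    qed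
    ultimately show False
      using fin finite_subset range_inj_infinite by metis
  qed
  have "?v ` root_coeffs k \<zeta> \<subseteq> {z. z ^ k = 1}"
    by (auto simp: root_coeffs_def)
  then have "card (root_coeffs k \<zeta>) \<le> card {z::complex. z ^ k = 1}"
    using k by (intro card_inj_on_le[OF inj]) (auto intro: finite_roots_unity)
  also have "\<dots> = k" using k by (simp add: card_roots_unity_eq)
  finally show ?thesis .
qed

text \<open>
  An infinite sum has the value 0, which is the sum over the empty set, so both
  cases reduce to a finite set of exponents.
\<close>

lemma cyclo_F_as_finite_sum:
  assumes "k \<ge> 1"
  obtains A where "finite A" "card A \<le> k" "A \<subseteq> {..<totient k} \<rightarrow>\<^sub>E UNIV"
    "\<And>x. cyclo_F k \<zeta> x = (\<Sum>a\<in>A. \<Prod>i<totient k. x (Suc i) powi a i)"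
proof (cases "finite (root_coeffs k \<zeta>)")
  case True
  then show ?thesis
    by (intro that[of "root_coeffs k \<zeta>"])
       (auto simp: root_coeffs_def cyclo_F_def intro: card_root_coeffs_le[OF assms True, unfolded root_coeffs_def])
next
  case False
  then show ?thesis by (intro that[of "{}"]) (auto simp: cyclo_F_def)
qed

lemma cyclo_poly_mahler_bound:
  assumes k: "k \<ge> 1"
  shows "mahler_integrable (totient k + 1) (cyclo_poly k \<zeta>)"
    and "mahler_measure (totient k + 1) (cyclo_poly k \<zeta>) \<le> ln (real k + 1) / 2"
proof -
  let ?d = "totient k"
  obtain A where A: "finite A" "card A \<le> k" "A \<subseteq> {..<?d} \<rightarrow>\<^sub>E UNIV"
    and F: "\<And>x. cyclo_F k \<zeta> x = (\<Sum>a\<in>A. \<Prod>i<?d. x (Suc i) powi a i)"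
    by (rule cyclo_F_as_finite_sum[OF k, of \<zeta>]) (rule that)
  (* The exponent vectors in all variables: e0 for x 0, and shift a for the monomials of F, which
     do not contain x 0. *)
  define e0 :: "nat \<Rightarrow> int" where "e0 = (\<lambda>i. if i = 0 then 1 else 0)"
  define shift :: "(nat \<Rightarrow> int) \<Rightarrow> nat \<Rightarrow> int" where "shift a = case_nat 0 a" for a
  define E where "E = insert e0 (shift ` A)"
  have shift: "monomial (Suc ?d) (shift a) x = (\<Prod>i<?d. x (Suc i) powi a i)" for a x
    by (simp add: monomial_def shift_def prod.lessThan_Suc_shift del: prod.lessThan_Suc)
  have e0: "monomial (Suc ?d) e0 x = x 0" for x
    by (simp add: monomial_def e0_def prod.lessThan_Suc_shift del: prod.lessThan_Suc)
  have inj: "inj shift"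
  proof (intro injI ext)
    fix a b i assume "shift a = shift b"
    then have "shift a (Suc i) = shift b (Suc i)" by simp
    then show "a i = b i" by (simp add: shift_def)
  qed
  have notin: "e0 \<notin> shift ` A"
  proof
    assume "e0 \<in> shift ` A"
    then obtain a where "e0 = shift a" by blast
    then have "e0 0 = shift a 0" by simp
    then show False by (simp add: e0_def shift_def)
  qed
  have P: "cyclo_poly k \<zeta> = (\<lambda>x. \<Sum>e\<in>E. monomial (Suc ?d) e x)"
    using A(1) notin
    by (simp add: fun_eq_iff cyclo_poly_def F E_def e0 shift
        sum.reindex[OF inj_on_subset[OF inj subset_UNIV]])
  have "card E = Suc (card A)"
    unfolding E_def using A(1) notin card_image[OF inj_on_subset[OF inj subset_UNIV], of A] by simp
  then have card: "finite E" "card E \<le> Suc k"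
    using A by (simp_all add: E_def)
  have sep: "e = e'" if mem: "e \<in> E" "e' \<in> E" and eq: "\<forall>i<Suc ?d. e i = e' i" for e e'
  proof -
    have shift_0: "shift a 0 = 0" for a by (simp add: shift_def)
    have e0_0: "e0 0 = 1" by (simp add: e0_def)
    have "e 0 = e' 0" using eq by blast
    then consider "e = e0" "e' = e0" | a b where "a \<in> A" "b \<in> A" "e = shift a" "e' = shift b"
      using mem by (auto simp: E_def shift_0 e0_0)
    then show ?thesis
    proof cases
      case 2
      have "a i = b i" if "i < ?d" for i
        using eq[rule_format, of "Suc i"] that 2 by (simp add: shift_def)
      then have "a = b"
        using A(3) 2 by (intro PiE_ext[of a "{..<?d}" _ b]) auto
      then show ?thesis using 2 by simp
    qed simp
  qed
  have inv: "(\<integral>\<^sup>+x. inverse (ennreal (sqrt (norm (cyclo_poly k \<zeta> x)))) \<partial>torus_haar (Suc ?d)) \<le> 2"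
    unfolding cyclo_poly_def
  proof (rule nn_integral_inverse_sqrt_torus)
    show "cyclo_F k \<zeta> \<in> borel_measurable (torus_haar (Suc ?d))"
      unfolding F[abs_def] shift[symmetric] by measurable
    show "cyclo_F k \<zeta> (x(0 := z)) = cyclo_F k \<zeta> x" for x z
      by (simp add: F)
  qed
  from inv have fin: "(\<integral>\<^sup>+x. inverse (ennreal (sqrt (norm (cyclo_poly k \<zeta> x)))) \<partial>torus_haar (Suc ?d)) < \<infinity>"
    by (rule le_less_trans) simp
  have meas: "cyclo_poly k \<zeta> \<in> borel_measurable (torus_haar (Suc ?d))"
    unfolding P by measurable
  have sq: "integrable (torus_haar (Suc ?d)) (\<lambda>x. (norm (cyclo_poly k \<zeta> x))\<^sup>2)"
    unfolding P by (rule torus_parseval(1)[OF card(1)]) (rule sep)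
  have "(\<integral>x. (norm (cyclo_poly k \<zeta> x))\<^sup>2 \<partial>torus_haar (Suc ?d)) = card E"
    unfolding P by (rule torus_parseval(2)[OF card(1)]) (rule sep)
  then have mean: "(\<integral>x. (norm (cyclo_poly k \<zeta> x))\<^sup>2 \<partial>torus_haar (Suc ?d)) \<le> real k + 1"
    using card(2) by linarith
  have pos: "real k + 1 > 0" by simp
  show "mahler_integrable (totient k + 1) (cyclo_poly k \<zeta>)"
    and "mahler_measure (totient k + 1) (cyclo_poly k \<zeta>) \<le> ln (real k + 1) / 2"
    unfolding Suc_eq_plus1[symmetric]
    by (rule mahler_measure_le_half_ln_L2[OF meas sq mean pos fin])+
qed

theorem proposition6p1p2:
  shows "(\<forall>(k::nat) (\<zeta>::complex). k \<ge> 1 \<and> primitive_root_of_unity k \<zeta> \<longrightarrow>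
            mahler_integrable (totient k + 1) (cyclo_poly k \<zeta>) \<and>
            mahler_measure (totient k + 1) (cyclo_poly k \<zeta>) \<le> ln (real k + 1) / 2)
       \<and> (\<lambda>k::nat. ln (real k + 1) / 2 - (ln (real k) / 2 + 1 / (2 * real k)))
            \<in> O[at_top](\<lambda>k. 1 / (real k)\<^sup>2)"
proof
  show "(\<lambda>k::nat. ln (real k + 1) / 2 - (ln (real k) / 2 + 1 / (2 * real k)))
            \<in> O[at_top](\<lambda>k. 1 / (real k)\<^sup>2)"
    by real_asymp
qed (use cyclo_poly_mahler_bound in auto)

end
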